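(* $p(K_5)=7$.
   Context: $K_n$ is the complete graph on $n$ vertices. An edge-coloring of a graph $G$ is any assignment of colors to its edges. A parity walk (in an edge-coloring) is a walk along which every color is used an even number of times. A parity path is a parity walk that is a path with at least one edge. A parity edge-coloring is an edge-coloring having no parity path, and $p(G)$ is the minimum number of colors in a parity edge-coloring of $G$. *)

theory Defs
  imports "Graph_Theory.Graph_Theory"
begin

(* In the Graph_Theory library a finite simple undirected graph is a digraph satisfying the
   locale "graph": loop-free, without parallel arcs, and with each edge uv present as the two
   arcs (u,v) and (v,u).  The undirected edge is recovered as the set of the two ends of an arc,
   so that both orientations carry the same color, whichever way a walk traverses the edge. *)
definition edge_of :: "('a, 'b) pre_digraph \<Rightarrow> 'b \<Rightarrow> 'a set" where
  "edge_of G e = {tail G e, head G e}"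

definition edges :: "('a, 'b) pre_digraph \<Rightarrow> 'a set set" where
  "edges G = edge_of G ` arcs G"

(* An edge-coloring is an arbitrary function on edges; its values off "edges G" are never used.
   Uses of a color are counted with multiplicity along the walk. *)
definition parity_walk ::
    "('a, 'b) pre_digraph \<Rightarrow> ('a set \<Rightarrow> 'c) \<Rightarrow> 'a \<Rightarrow> 'b awalk \<Rightarrow> 'a \<Rightarrow> bool" where
  "parity_walk G c u p v \<longleftrightarrow> pre_digraph.awalk G u p v \<and>
     (\<forall>k. even (count_list (map (c \<circ> edge_of G) p) k))"

definition parity_path ::
    "('a, 'b) pre_digraph \<Rightarrow> ('a set \<Rightarrow> 'c) \<Rightarrow> 'a \<Rightarrow> 'b awalk \<Rightarrow> 'a \<Rightarrow> bool" where
  "parity_path G c u p v \<longleftrightarrow> parity_walk G c u p v \<and> pre_digraph.apath G u p v \<and> p \<noteq> []"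

definition parity_edge_coloring :: "('a, 'b) pre_digraph \<Rightarrow> ('a set \<Rightarrow> 'c) \<Rightarrow> bool" where
  "parity_edge_coloring G c \<longleftrightarrow> (\<nexists>u p v. parity_path G c u p v)"

(* Meant for finite graphs.  Natural numbers suffice as colors there, and the minimum is
   attained since coloring all edges differently leaves no parity path. *)
definition parity_edge_chromatic_number :: "('a, 'b) pre_digraph \<Rightarrow> nat" where
  "parity_edge_chromatic_number G =
     (LEAST k. \<exists>c :: 'a set \<Rightarrow> nat. parity_edge_coloring G c \<and>
        finite (c ` edges G) \<and> card (c ` edges G) = k)"

end

(* Lower bound: color classes are matchings, hence have at most two edges in K_5, and two edges
   ab, df of equal color miss exactly one vertex v.  If an edge at v also repeated its color,
   then two two-edge classes would form a Hamiltonian path whose colors alternate, a parity path.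
   So some vertex v has four edges whose colors occur nowhere else; together with the three
   remaining edges at a second vertex they use seven colors.

   Upper bound: label the vertices by distinct bit vectors and color xy by the sum of the labels.
   Along a walk the colors add up to the sum of the two end labels, so a parity walk is closed.
   For five vertices three bits suffice, and the zero vector is not a color. *)
theory Submission
  imports Defs
begin

unbundle bit_operations_syntax

section \<open>Vertex lists and walks in a complete graph\<close>

lemma edges_complete_digraph:
  assumes "complete_digraph n G"
  shows "edges G = {{x, y} | x y. x \<in> verts G \<and> y \<in> verts G \<and> x \<noteq> y}"
proof -
  have "edges G = (\<lambda>(x, y). {x, y}) ` arcs_ends G"
    by (auto simp: edges_def edge_of_def arcs_ends_def arc_to_ends_def image_image)
  then show ?thesis
    using assms by (auto simp: complete_digraph_def)
qed

lemma complete_digraph_arc: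
  assumes "complete_digraph n G" "x \<in> verts G" "y \<in> verts G" "x \<noteq> y"
  obtains e where "e \<in> arcs G" "tail G e = x" "head G e = y"
proof -
  have "(x, y) \<in> arcs_ends G"
    using assms by (auto simp: complete_digraph_def)
  then show thesis
    using that by (auto simp: arcs_ends_def arc_to_ends_def)
qed

text \<open>The arc type is arbitrary, so arcs are chosen one by one along the list. Afterwards
  paths can be handled purely as lists of vertices.\<close>

lemma complete_digraph_awalk:
  assumes "complete_digraph n G" "xs \<noteq> []" "distinct xs" "set xs \<subseteq> verts G"
  shows "\<exists>p. pre_digraph.awalk G (hd xs) p (last xs) \<and> pre_digraph.awalk_verts G (hd xs) p = xs
    \<and> map (edge_of G) p = map2 (\<lambda>x y. {x, y}) xs (tl xs)"
  using assms(2-)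
proof (induction xs rule: list_nonempty_induct)
  case (single x)
  interpret graph G using assms(1) by (simp add: complete_digraph_def)
  show ?case using single by (intro exI[of _ "[]"]) (simp add: awalk_Nil_iff)
next
  case (cons x xs)
  interpret graph G using assms(1) by (simp add: complete_digraph_def)
  obtain y ys where xs: "xs = y # ys" using cons.hyps by (cases xs) auto
  obtain p where p: "awalk y p (last xs)" "awalk_verts y p = xs"
      "map (edge_of G) p = map2 (\<lambda>x y. {x, y}) xs (tl xs)"
    using cons xs by auto
  obtain e where e: "e \<in> arcs G" "tail G e = x" "head G e = y"
    using complete_digraph_arc[OF assms(1), of x y] cons.prems xs by auto
  show ?case
    using p e xs by (intro exI[of _ "e # p"]) (simp add: awalk_Cons_iff, simp add: edge_of_def)
qed

text \<open>The working form of the hypothesis on \<open>c\<close>: zipping \<open>xs\<close> with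
  \<open>tl xs\<close> yields the consecutive edges of a path, and \<open>tl xs \<noteq> []\<close>
  gives it at least one edge.\<close>

lemma parity_edge_coloring_distinct:
  assumes "complete_digraph n G" "parity_edge_coloring G c"
    and "distinct xs" "set xs \<subseteq> verts G" "tl xs \<noteq> []"
  shows "\<exists>k. odd (count_list (map c (map2 (\<lambda>x y. {x, y}) xs (tl xs))) k)"
proof (rule ccontr)
  assume even: "\<not> ?thesis"
  have "xs \<noteq> []" using assms(5) by auto
  then obtain p where p: "pre_digraph.awalk G (hd xs) p (last xs)"
      "pre_digraph.awalk_verts G (hd xs) p = xs"
      "map (edge_of G) p = map2 (\<lambda>x y. {x, y}) xs (tl xs)"
    using complete_digraph_awalk[OF assms(1) _ assms(3,4)] by blast
  have "p \<noteq> []" using p(3) assms(5) by (cases xs; cases "tl xs") auto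
  moreover have "map (c \<circ> edge_of G) p = map c (map2 (\<lambda>x y. {x, y}) xs (tl xs))"
    by (simp flip: p(3))
  ultimately have "parity_path G c (hd xs) p (last xs)"
    using p even assms(3)
    by (simp add: parity_path_def parity_walk_def pre_digraph.apath_def)
  then show False using assms(2) unfolding parity_edge_coloring_def by blast
qed

section \<open>Lower bound: repeated colors in a parity edge-coloring\<close>

lemma parity_edge_coloring_disjoint:
  assumes K: "complete_digraph n G" "parity_edge_coloring G c"
    and e: "e \<in> edges G" "e' \<in> edges G" "c e = c e'" "e \<noteq> e'"
  shows "e \<inter> e' = {}"
proof (rule ccontr)
  assume "e \<inter> e' \<noteq> {}"
  then obtain y where "y \<in> e" "y \<in> e'" by blast
  then obtain x z where xz: "e = {x, y}" "e' = {y, z}" "distinct [x, y, z]"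
      "{x, y, z} \<subseteq> verts G"
    using e unfolding edges_complete_digraph[OF K(1)] by (fastforce simp: doubleton_eq_iff)
  \<comment> \<open>Two edges of one color sharing \<open>y\<close> would form a parity path with
    two edges.\<close>
  then obtain k where "odd (count_list [c {x, y}, c {y, z}] k)"
    using parity_edge_coloring_distinct[OF K, of "[x, y, z]"] by auto
  then show False using e(3) xz by (simp split: if_splits)
qed

text \<open>A color pattern A, B, A, B along four edges makes every count even, also when A =
  B.\<close>

lemma parity_edge_coloring_not_alternating:
  assumes "complete_digraph n G" "parity_edge_coloring G c"
    and "distinct [x, y, z, w, t]" "{x, y, z, w, t} \<subseteq> verts G"
    and "c {x, y} = c {z, w}"
  shows "c {y, z} \<noteq> c {w, t}"
proof
  assume eq: "c {y, z} = c {w, t}"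
  have "map c (map2 (\<lambda>x y. {x, y}) [x, y, z, w, t] (tl [x, y, z, w, t]))
      = [c {x, y}, c {y, z}, c {x, y}, c {y, z}]"
    using eq assms(5) by simp
  moreover have "even (count_list [c {x, y}, c {y, z}, c {x, y}, c {y, z}] k)" for k by simp
  moreover have "set [x, y, z, w, t] \<subseteq> verts G" using assms(4) by simp
  ultimately show False
    using parity_edge_coloring_distinct[OF assms(1-3)] by (metis list.distinct(1) list.sel(3))
qed

text \<open>A second edge of the color of \<open>{v, x}\<close> avoids \<open>v\<close> and
  \<open>x\<close>, so it lies among the other three vertices. Each of the three possible positions
  is excluded by a path with two or four edges.\<close>

lemma unique_color_of_missed_vertex:
  assumes K: "complete_digraph n G" "parity_edge_coloring G c"
    and V: "verts G = {v, a, b, d, f}" "distinct [v, a, b, d, f]"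
    and eq: "c {a, b} = c {d, f}"
    and xyz: "x \<in> verts G - {v}" "y \<in> verts G" "z \<in> verts G" "y \<noteq> z"
    and cxyz: "c {v, x} = c {y, z}"
  shows "{y, z} = {v, x}"
proof (rule ccontr)
  assume ne: "{y, z} \<noteq> {v, x}"
  note E = edges_complete_digraph[OF K(1)]
  note alt = parity_edge_coloring_not_alternating[OF K]
  have "{v, x} \<in> edges G" "{y, z} \<in> edges G" using xyz V(1) unfolding E by auto
  then have "{v, x} \<inter> {y, z} = {}"
    using parity_edge_coloring_disjoint[OF K] cxyz ne by metis
  then have yz: "y \<in> verts G - {v, x}" "z \<in> verts G - {v, x}" using xyz by auto
  \<comment> \<open>Here \<open>p\<close> is the partner of \<open>x\<close> in the equally colored
    pair and \<open>{q, r}\<close> is the other edge of that pair. If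
    \<open>{y, z} = {q, r}\<close>, the edges \<open>{v, x}\<close> and \<open>{x, p}\<close> share
    a color and the vertex \<open>x\<close>; otherwise the path v, x, p, q, r or v, x, p, r, q
    alternates.\<close>
  have key: False
    if pq: "c {x, p} = c {q, r}" "distinct [v, x, p, q, r]" "verts G = {v, x, p, q, r}" for p q r
  proof -
    have "y \<in> {p, q, r}" "z \<in> {p, q, r}" using yz pq(3) by auto
    then have "{y, z} = {q, r} \<or> {y, z} = {p, q} \<or> {y, z} = {p, r}"
      using xyz(4) by auto
    then show False
    proof (elim disjE)
      assume "{y, z} = {q, r}"
      then have eq: "c {v, x} = c {x, p}" using pq(1) cxyz by simp
      have "{v, x} \<in> edges G" "{x, p} \<in> edges G" "{v, x} \<noteq> {x, p}"
        using pq(2,3) unfolding E by auto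
      then show False using parity_edge_coloring_disjoint[OF K _ _ eq] by simp
    next
      assume "{y, z} = {p, q}"
      then show False using alt[of v x p q r] pq cxyz by simp
    next
      assume "{y, z} = {p, r}"
      then show False using alt[of v x p r q] pq cxyz by (auto simp: insert_commute[of r q "{}"])
    qed
  qed
  have comm: "c {b, a} = c {a, b}" "c {f, d} = c {d, f}" by (simp_all add: insert_commute)
  have "x \<in> {a, b, d, f}" using xyz V(1) by auto
  then consider "x = a" | "x = b" | "x = d" | "x = f" by blast
  then show False
  proof cases
    case 1
    with V eq show False by (intro key[of b d f]) auto
  next
    case 2
    with V eq comm show False by (intro key[of a d f]) auto
  next
    case 3
    with V eq show False by (intro key[of f a b]) auto
  next
    case 4
    with V eq comm show False by (intro key[of d a b]) auto
  qed
qed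

text \<open>If no color repeats, any vertex will do; otherwise the vertex missed by two equally
  colored edges is taken.\<close>

lemma ex_vertex_unique_colors:
  assumes K: "complete_digraph 5 G" "parity_edge_coloring G c"
  obtains v where "v \<in> verts G"
    and "\<And>x y z. x \<in> verts G - {v} \<Longrightarrow> y \<in> verts G \<Longrightarrow> z \<in> verts G \<Longrightarrow> y \<noteq> z
           \<Longrightarrow> c {v, x} = c {y, z} \<Longrightarrow> {y, z} = {v, x}"
proof (cases "inj_on c (edges G)")
  case True
  have "card (verts G) = 5" using K(1) by (simp add: complete_digraph_def)
  then obtain v where v: "v \<in> verts G" by fastforce
  show thesis
  proof (rule that[OF v])
    fix x y z
    assume "x \<in> verts G - {v}" "y \<in> verts G" "z \<in> verts G" "y \<noteq> z" "c {v, x} = c {y, z}"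
    moreover have "{v, x} \<in> edges G" "{y, z} \<in> edges G"
      using calculation v by (auto simp: edges_complete_digraph[OF K(1)])
    ultimately show "{y, z} = {v, x}" using True by (simp add: inj_on_def)
  qed
next
  case False
  then obtain a b d f where abdf: "{a, b, d, f} \<subseteq> verts G" "a \<noteq> b" "d \<noteq> f"
      "c {a, b} = c {d, f}" "{a, b} \<noteq> {d, f}"
    unfolding inj_on_def edges_complete_digraph[OF K(1)] by blast
  then have "{a, b} \<inter> {d, f} = {}"
    by (intro parity_edge_coloring_disjoint[OF K]) (auto simp: edges_complete_digraph[OF K(1)])
  then have dist: "distinct [a, b, d, f]" using abdf by auto
  have V: "card (verts G) = 5" using K(1) by (simp add: complete_digraph_def)
  then have "card (verts G - {a, b, d, f}) = 1"
    using abdf(1) dist by (subst card_Diff_subset) auto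
  then obtain v where "verts G - {a, b, d, f} = {v}" by (rule card_1_singletonE)
  then have v: "verts G = {v, a, b, d, f}" "distinct [v, a, b, d, f]"
    using abdf(1) dist by auto
  show thesis
    using that[of v] unique_color_of_missed_vertex[OF K v abdf(4)] v(1) by blast
qed

lemma card_colors_ge:
  assumes K: "complete_digraph 5 G" "parity_edge_coloring G c"
    and fin: "finite (c ` edges G)"
  shows "7 \<le> card (c ` edges G)"
proof -
  obtain v where v: "v \<in> verts G"
    and uniq: "\<And>x y z. x \<in> verts G - {v} \<Longrightarrow> y \<in> verts G \<Longrightarrow> z \<in> verts G \<Longrightarrow> y \<noteq> z
           \<Longrightarrow> c {v, x} = c {y, z} \<Longrightarrow> {y, z} = {v, x}"
    using ex_vertex_unique_colors[OF K] by blast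
  have V: "card (verts G) = 5" using K(1) by (simp add: complete_digraph_def)
  then have finV: "finite (verts G)" using card_ge_0_finite by force
  have card4: "card (verts G - {v}) = 4" using V v by simp
  then have "verts G - {v} \<noteq> {}" by force
  then obtain w where w: "w \<in> verts G - {v}" by blast
  let ?A = "(\<lambda>x. c {v, x}) ` (verts G - {v})"
  let ?B = "(\<lambda>x. c {w, x}) ` (verts G - {v} - {w})"
  have "inj_on (\<lambda>x. c {v, x}) (verts G - {v})"
  proof (rule inj_onI)
    fix x y assume "x \<in> verts G - {v}" "y \<in> verts G - {v}" "c {v, x} = c {v, y}"
    then show "x = y" using uniq[of x v y] v by (auto simp: doubleton_eq_iff)
  qed
  then have A: "card ?A = 4" using card4 by (simp add: card_image)
  have "inj_on (\<lambda>x. c {w, x}) (verts G - {v} - {w})"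
  proof (rule inj_onI)
    fix x y assume "x \<in> verts G - {v} - {w}" "y \<in> verts G - {v} - {w}" "c {w, x} = c {w, y}"
    moreover from this have "{w, x} \<in> edges G" "{w, y} \<in> edges G"
      using w unfolding edges_complete_digraph[OF K(1)] by auto
    ultimately have "{w, x} = {w, y}"
      using parity_edge_coloring_disjoint[OF K, of "{w, x}" "{w, y}"] by auto
    then show "x = y" by (auto simp: doubleton_eq_iff)
  qed
  then have B: "card ?B = 3" using card4 w by (simp add: card_image)
  \<comment> \<open>Equality would force \<open>{w, y} = {v, x}\<close>, but \<open>v\<close> is
    neither \<open>w\<close> nor \<open>y\<close>.\<close>
  have "c {v, x} \<noteq> c {w, y}" if "x \<in> verts G - {v}" "y \<in> verts G - {v} - {w}" for x y
    using uniq[of x w y] that w by (auto simp: doubleton_eq_iff)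
  then have "?A \<inter> ?B = {}" by blast
  then have "card (?A \<union> ?B) = 7" using A B finV by (simp add: card_Un_disjoint)
  moreover have "?A \<union> ?B \<subseteq> c ` edges G"
    using v w unfolding edges_complete_digraph[OF K(1)] by blast
  ultimately show ?thesis using card_mono[OF fin] by metis
qed

section \<open>Upper bound: coloring by the XOR of vertex labels\<close>

lemma foldr_xor_remove1:
  fixes xs :: "nat list"
  assumes "x \<in> set xs"
  shows "foldr (XOR) xs 0 = x XOR foldr (XOR) (remove1 x xs) 0"
  using assms by (induction xs) (auto simp: xor.left_commute)

text \<open>The head of the list occurs again in its tail; the two copies cancel, and the remaining
  list is shorter and still has even counts.\<close>

lemma foldr_xor_even:
  fixes xs :: "nat list"
  assumes "\<forall>k. even (count_list xs k)"
  shows "foldr (XOR) xs 0 = 0"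
  using assms
proof (induction xs rule: length_induct)
  case (1 xs)
  show ?case
  proof (cases xs)
    case (Cons x ys)
    then have "odd (count_list ys x)" using 1(2)[rule_format, of x] by simp
    then have x: "x \<in> set ys" using count_list_0_iff[of ys x] by (cases "x \<in> set ys") auto
    have cnt: "count_list ys k = (if k = x then 1 else 0) + count_list (remove1 x ys) k" for k
      using x by (induction ys) auto
    have "even (count_list (remove1 x ys) k)" for k
      using 1(2)[rule_format, of k] cnt[of k] Cons by (auto split: if_splits)
    then have "foldr (XOR) (remove1 x ys) 0 = 0"
      by (intro 1(1)[rule_format]) (auto simp: Cons length_remove1)
    then show ?thesis using Cons foldr_xor_remove1[OF x] by (simp add: xor.assoc[symmetric])
  qed simp
qed

text \<open>Minimum and maximum serve only to extract both labels of an edge from the unordered pair.\<close>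

definition xor_coloring :: "('a \<Rightarrow> nat) \<Rightarrow> 'a set \<Rightarrow> nat" where
  "xor_coloring l e = Min (l ` e) XOR Max (l ` e)"

lemma xor_coloring_doubleton: "xor_coloring l {x, y} = l x XOR l y"
  by (cases "l x \<le> l y") (auto simp: xor_coloring_def min_def max_def xor.commute)

text \<open>The sum telescopes: the label of each intermediate vertex enters twice and
  cancels.\<close>

lemma foldr_xor_coloring_awalk:
  assumes "pre_digraph.awalk G u p v"
  shows "foldr (XOR) (map (xor_coloring l \<circ> edge_of G) p) 0 = l u XOR l v"
proof -
  have "pre_digraph.cas G u p v" using assms by (simp add: pre_digraph.awalk_def)
  then show ?thesis
  proof (induction p arbitrary: u)
    case Nil
    then show ?case by (simp add: pre_digraph.cas.simps)
  next
    case (Cons e p)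
    have "(l u XOR l w) XOR (l w XOR l v) = l u XOR l v" for w
      by (simp add: xor.assoc flip: xor.assoc[of "l w" "l w"])
    with Cons show ?case
      by (auto simp: pre_digraph.cas.simps edge_of_def xor_coloring_doubleton)
  qed
qed

lemma parity_edge_coloring_xor:
  assumes "wf_digraph G" "inj_on l (verts G)"
  shows "parity_edge_coloring G (xor_coloring l)"
  unfolding parity_edge_coloring_def
proof (safe)
  fix u p v assume "parity_path G (xor_coloring l) u p v"
  then have walk: "parity_walk G (xor_coloring l) u p v"
    and path: "pre_digraph.apath G u p v" "p \<noteq> []" by (auto simp: parity_path_def)
  interpret wf_digraph G by (fact assms(1))
  have "l u XOR l v = 0"
    using walk foldr_xor_even foldr_xor_coloring_awalk unfolding parity_walk_def by metis
  then have "l u = l v" by (metis xor.assoc xor.right_neutral xor_self_eq xor.left_neutral)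
  moreover have "u \<in> verts G" "v \<in> verts G"
    using path awalkI_apath awalk_hd_in_verts awalk_last_in_verts by blast+
  \<comment> \<open>Equal labels give \<open>u = v\<close>, whereas a path with at least one edge
    has distinct ends.\<close>
  ultimately show False using assms(2) apath_nonempty_ends[OF path] by (auto dest: inj_onD)
qed

lemma xor_coloring_range:
  assumes "complete_digraph n G" "inj_on l (verts G)" "l ` verts G \<subseteq> {..<2 ^ k}"
  shows "xor_coloring l ` edges G \<subseteq> {1..<2 ^ k}"
proof -
  have "l x XOR l y \<in> {1..<2 ^ k}" if xy: "x \<in> verts G" "y \<in> verts G" "x \<noteq> y" for x y
  proof -
    have "l x < 2 ^ k" "l y < 2 ^ k" using assms(3) xy by auto
    \<comment> \<open>Being below \<open>2 ^ k\<close> means being fixed by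
      \<open>take_bit k\<close>, and truncation to \<open>k\<close> bits commutes with XOR.\<close>
    then have "take_bit k (l x XOR l y) = l x XOR l y"
      by (simp add: take_bit_nat_eq_self)
    then have "l x XOR l y < 2 ^ k" by (simp only: take_bit_nat_eq_self_iff)
    moreover have "l x \<noteq> l y" using assms(2) xy by (auto dest: inj_onD)
    then have "l x XOR l y \<noteq> 0"
      by (metis xor.assoc xor.right_neutral xor_self_eq xor.left_neutral)
    ultimately show ?thesis by auto
  qed
  then show ?thesis
    by (auto simp: edges_complete_digraph[OF assms(1)] xor_coloring_doubleton)
qed

theorem proposition5p1:
  fixes G :: "('a, 'b) pre_digraph"
  assumes "complete_digraph 5 G"
  shows "parity_edge_chromatic_number G = 7"
  unfolding parity_edge_chromatic_number_def
proof (rule Least_equality)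
  interpret graph G using assms by (simp add: complete_digraph_def)
  \<comment> \<open>Numbering the vertices from 0 to 4 gives labels that fit into three
    bits.\<close>
  obtain l where "bij_betw l (verts G) {0..<card (verts G)}"
    using ex_bij_betw_finite_nat finite_verts by blast
  then have l: "inj_on l (verts G)" "l ` verts G \<subseteq> {..<2 ^ 3}"
    using assms by (auto simp: bij_betw_def complete_digraph_def)
  have pec: "parity_edge_coloring G (xor_coloring l)"
    using parity_edge_coloring_xor wf_digraph l(1) by blast
  have sub: "xor_coloring l ` edges G \<subseteq> {1..<2 ^ 3}"
    using xor_coloring_range[OF assms l] .
  then have fin: "finite (xor_coloring l ` edges G)" by (rule finite_subset) simp
  \<comment> \<open>The nonzero three-bit values bound the number of colors by 7; equality, which
    the minimum asks for, comes from the lower bound applied to this coloring.\<close>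
  have "card (xor_coloring l ` edges G) = 7"
    using card_colors_ge[OF assms pec fin] card_mono[OF _ sub] by simp
  with pec fin show "\<exists>c :: 'a set \<Rightarrow> nat. parity_edge_coloring G c \<and>
      finite (c ` edges G) \<and> card (c ` edges G) = 7" by blast
next
  fix k assume "\<exists>c :: 'a set \<Rightarrow> nat. parity_edge_coloring G c \<and>
      finite (c ` edges G) \<and> card (c ` edges G) = k"
  then show "7 \<le> k" using card_colors_ge[OF assms] by blast
qed

end
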